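(* Let $p\ge5$ be an integer. The probability density function of the random eigenvalue $\Lambda^*_{p,0}$ of a dual $(p,0)$-nanotube is given by $$f_{\Lambda_{p,0}^*}(x)=\frac{1}{p\pi}\sum_{j=0}^{p-1}\frac{\mathbf{1}\{x\in\mathcal{I}_j\}}{\sqrt{8\left(1+\cos\left(\frac{2\pi j}{p}\right)\right)-\left(3+2\cos\left(\frac{2\pi j}{p}\right)-x\right)^2}}$$ with the open intervals $$\mathcal{I}_j=\left(\left(2\left|\cos\left(\frac{\pi j}{p}\right)\right|-1\right)^2,\ \left(2\left|\cos\left(\frac{\pi j}{p}\right)\right|+1\right)^2\right),\quad j=0,\ldots,p-1.$$
   Context: $\mathbb{N}_0=\{0,1,2,\ldots\}$. For $(p,q)\in\mathbb{N}_0^2$ with $q\le p$ and $p+q\ge5$, $\Lambda^*_{p,q}$ denotes the random eigenvalue of the dual infinite $(p,q)$-nanotube (the triangular lattice with a loop of weight $3$ at each vertex, rolled up along the chiral vector $(p,q)$), i.e. the real random variable with compactly supported distribution whose moments $\mu_k(\Lambda^*_{p,q})=\mathbb{E}(\Lambda^*_{p,q})^k$, $k\in\mathbb{N}_0$, are the (weighted) numbers of closed paths with $k$ steps from a vertex of this graph, given by $$\mu_k(\Lambda^*_{p,q})=\frac{1}{(2\pi)^3}\sum_{j\in\mathbb{Z}}\int_{-\pi}^{\pi}\int_{-\pi}^{\pi}\int_{-\pi}^{\pi}\left|e^{ix}+e^{iy}+e^{iz}\right|^{2k}e^{ij(p(x-z)+q(y-z))}\,dx\,dy\,dz .$$ For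 each fixed $k$ only finitely many terms of the sum are non-zero, and these moments determine the (compactly supported) distribution of $\Lambda^*_{p,q}$ uniquely. Terms whose indicator $\mathbf{1}\{x\in\mathcal{I}_j\}$ vanishes are understood as $0$.
   Formalization: For even p the stated density has total mass only 1 − 1/p, since the interval for j = p/2 is empty; the formal theorem proves the stated density for odd p, and for even p that the law is the stated density plus a point mass 1/p at x = 1. *)

theory Defs
  imports "HOL-Probability.Probability"
begin

text \<open>
  The k-th moment is kept complex-valued, as the integrand is complex. For fixed k only finitely
  many summands are non-zero, so the infinite sum is the honest one.
\<close>

definition dual_nanotube_moment :: "nat \<Rightarrow> nat \<Rightarrow> nat \<Rightarrow> complex" where
  "dual_nanotube_moment p q k =
     1 / (2 * of_real pi) ^ 3 *
     (\<Sum>\<^sub>\<infinity>j\<in>(UNIV :: int set).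
        LINT z:{-pi..pi}|lborel. LINT y:{-pi..pi}|lborel. LINT x:{-pi..pi}|lborel.
          of_real (cmod (exp (\<i> * of_real x) + exp (\<i> * of_real y) + exp (\<i> * of_real z)) ^ (2 * k)) *
          exp (\<i> * of_real (real_of_int j * (real p * (x - z) + real q * (y - z)))))"

definition dual_nanotube_eigenvalue ::
    "nat \<Rightarrow> nat \<Rightarrow> 'a measure \<Rightarrow> ('a \<Rightarrow> real) \<Rightarrow> bool" where
  "dual_nanotube_eigenvalue p q M X \<longleftrightarrow>
     prob_space M \<and> X \<in> borel_measurable M \<and>
     (\<exists>K. compact K \<and> (AE \<omega> in M. X \<omega> \<in> K)) \<and>
     (\<forall>k. complex_of_real (\<integral>\<omega>. X \<omega> ^ k \<partial>M) = dual_nanotube_moment p q k)"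

definition zigzag_interval :: "nat \<Rightarrow> nat \<Rightarrow> real set" where
  "zigzag_interval p j =
     {(2 * \<bar>cos (pi * real j / real p)\<bar> - 1)\<^sup>2 <..< (2 * \<bar>cos (pi * real j / real p)\<bar> + 1)\<^sup>2}"

text \<open>
  The radicand is positive exactly on the interval with index j; elsewhere the indicator makes the
  summand 0. If p is even and j = p / 2, the interval is
  empty: the corresponding arcsine law degenerates to the point mass at 1, so the density then has
  total mass 1 - 1 / p only.
\<close>

definition zigzag_density :: "nat \<Rightarrow> real \<Rightarrow> real" where
  "zigzag_density p x =
     1 / (real p * pi) *
     (\<Sum>j = 0..p - 1.
        indicator (zigzag_interval p j) x /
        sqrt (8 * (1 + cos (2 * pi * real j / real p))
              - (3 + 2 * cos (2 * pi * real j / real p) - x)\<^sup>2))"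

end

theory Submission
  imports Defs
begin

text \<open>
  The sum over j of the Fourier integrals samples the trigonometric polynomial
  |exp(i x) + exp(i y) + exp(i z)|^(2k) in x - z at the p-th roots of unity. Since
  |1 + exp(i t)| = 2 |cos (t/2)|, the moments are those of 1 + r^2 - 2 r cos v, where v is uniform
  on [0, pi] and r = 2 |cos (pi m / p)| with m uniform on {0, ..., p - 1}. A bounded random variable
  is determined in law by its moments, because they give its characteristic function. Conditionally
  on m the law is an arcsine law, or the point mass at 1 when r = 0, that is, when 2 m = p.
\<close>

section \<open>Trigonometric polynomials\<close>

text \<open>For an antiderivative \<open>F\<close> of \<open>f\<close> on the whole line, the
  increment \<open>F (u + 2 * pi) - F u\<close> has derivative 0 by periodicity, hence is constant.
  Each shifted integral is this increment at \<open>u = -pi - w\<close>.\<close>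

lemma periodic_set_integral_shift:
  fixes f :: "real \<Rightarrow> 'a::euclidean_space"
  assumes cont: "continuous_on UNIV f" and per: "\<And>x. f (x + 2 * pi) = f x"
  shows "(LINT x:{-pi..pi}|lborel. f (x - w)) = (LINT x:{-pi..pi}|lborel. f x)"
proof -
  have "\<exists>F. \<forall>x::real. (-\<infinity>::ereal) < x \<longrightarrow> x < (\<infinity>::ereal) \<longrightarrow> (F has_vector_derivative f x) (at x)"
    using cont by (intro einterval_antiderivative) (auto simp: continuous_on_eq_continuous_at)
  then obtain F where F: "\<And>x. (F has_vector_derivative f x) (at x)"
    by auto
  have shifted: "(LINT x:{-pi..pi}|lborel. f (x - w)) = F (pi - w) - F (-pi - w)" for w
    unfolding set_lebesgue_integral_def
  proof (rule integral_FTC_atLeastAtMost)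
    show "((\<lambda>x. F (x - w)) has_vector_derivative f (x - w)) (at x within {-pi..pi})" for x
    proof -
      have "((\<lambda>x. x - w) has_vector_derivative 1) (at x within {-pi..pi})"
        by (auto intro!: derivative_eq_intros)
      from vector_diff_chain_within[OF this has_vector_derivative_at_within[OF F]]
      show ?thesis by (simp add: o_def)
    qed
    show "continuous_on {-pi..pi} (\<lambda>x. f (x - w))"
      by (intro continuous_on_compose2[OF cont] continuous_intros) auto
  qed simp
  have "((\<lambda>u. F (u + 2 * pi) - F u) has_vector_derivative f (u + 2 * pi) - f u) (at u)" for u
  proof -
    have "((\<lambda>u. u + 2 * pi) has_vector_derivative 1) (at u)"
      by (auto intro!: derivative_eq_intros)
    from vector_diff_chain_at[OF this F] have "((\<lambda>u. F (u + 2 * pi)) has_vector_derivative f (u + 2 * pi)) (at u)"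
      by (simp add: o_def)
    then show ?thesis by (intro has_vector_derivative_diff F)
  qed
  then obtain c where "\<And>u. F (u + 2 * pi) - F u = c"
    using has_vector_derivative_zero_constant[of UNIV "\<lambda>u. F (u + 2 * pi) - F u"] per by auto
  from this[of "-pi - w"] this[of "-pi"] show ?thesis
    using shifted[of w] shifted[of 0] by (simp add: algebra_simps)
qed

lemma set_integral_exp_int:
  "(LINT x:{-pi..pi}|lborel. exp (\<i> * of_real x * of_int n)) = (if n = 0 then 2 * of_real pi else 0)"
proof (cases "n = 0")
  case False
  have "(LINT x:{-pi..pi}|lborel. exp (\<i> * of_real x * of_int n)) =
      exp (\<i> * of_real pi * of_int n) / (\<i> * of_int n) - exp (\<i> * of_real (-pi) * of_int n) / (\<i> * of_int n)"
    unfolding set_lebesgue_integral_def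
  proof (rule integral_FTC_atLeastAtMost)
    show "((\<lambda>x. exp (\<i> * of_real x * of_int n) / (\<i> * of_int n)) has_vector_derivative
        exp (\<i> * of_real x * of_int n)) (at x within {-pi..pi})" for x
      using False
      by (auto intro!: derivative_eq_intros has_vector_derivative_real_field simp: field_simps)
  qed (auto intro!: continuous_intros)
  \<comment> \<open>The two exponents differ by \<open>n\<close> times the period of the
    exponential, which gives the witness \<open>n\<close> in \<open>exp_eq\<close>.\<close>
  also have "exp (\<i> * of_real pi * of_int n) = exp (\<i> * of_real (-pi) * of_int n)"
    unfolding exp_eq by (intro exI[of _ n]) (simp add: algebra_simps)
  finally show ?thesis using False by simp
next
  case True
  then show ?thesis by (simp add: set_integral_const scaleR_conv_of_real)
qed

text \<open>The sum is geometric with ratio \<open>w\<close>. If \<open>p\<close> divides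
  \<open>n\<close> then \<open>w = 1\<close> and all terms are 1; otherwise \<open>w ^ p = 1\<close>
  makes the numerator of the closed form vanish.\<close>

lemma sum_exp_roots:
  fixes n :: int
  assumes "p > 0"
  shows "(\<Sum>m<p. exp (\<i> * of_real (2 * pi * real m / real p) * of_int n)) = (if int p dvd n then of_nat p else 0)"
proof -
  define w where "w = exp (\<i> * of_real (2 * pi / real p) * of_int n)"
  have eq: "(\<Sum>m<p. exp (\<i> * of_real (2 * pi * real m / real p) * of_int n)) = (\<Sum>m<p. w ^ m)"
    unfolding w_def by (intro sum.cong refl) (simp add: exp_of_nat_mult[symmetric] algebra_simps)
  have w1: "w = 1 \<longleftrightarrow> int p dvd n"
  proof -
    have "w = 1 \<longleftrightarrow> (\<exists>m::int. real_of_int n / real p = of_int m)"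
    proof -
      have "2 * pi / real p * real_of_int n = of_int (2 * m) * pi \<longleftrightarrow> real_of_int n / real p = of_int m" for m :: int
        using assms by (auto simp: field_simps)
      then show ?thesis unfolding w_def exp_eq_1 by simp
    qed
    also have "\<dots> \<longleftrightarrow> (\<exists>m::int. n = int p * m)"
    proof -
      have "real_of_int n / real p = of_int m \<longleftrightarrow> n = int p * m" for m :: int
      proof -
        have "real_of_int n / real p = of_int m \<longleftrightarrow> real_of_int n = of_int (int p * m)"
          using assms by (simp add: field_simps)
        then show ?thesis by linarith
      qed
      then show ?thesis by simp
    qed
    finally show ?thesis by (simp add: dvd_def)
  qed
  have "w ^ p = exp (of_int n * (of_real (2 * pi) * \<i>))"
    unfolding w_def using assms by (simp add: exp_of_nat_mult[symmetric] field_simps)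
  also have "\<dots> = 1"
    by (subst exp_eq_1) (auto simp: algebra_simps)
  finally have "w ^ p = 1" .
  then show ?thesis
    unfolding eq using w1 by (auto simp: sum_gp_strict)
qed

text \<open>Orthogonality of the characters. The frequency map \<open>\<phi>\<close> may repeat
  values, so that a binomial double sum can be used without collecting equal frequencies.\<close>

lemma fourier_coefficient_trig_poly:
  fixes c :: "'i \<Rightarrow> complex" and \<phi> :: "'i \<Rightarrow> int"
  assumes "finite S"
  shows "(LINT x:{-pi..pi}|lborel. (\<Sum>i\<in>S. c i * exp (\<i> * of_real x * of_int (\<phi> i))) * exp (\<i> * of_real x * of_int n)) =
    (\<Sum>i\<in>S. c i * (if \<phi> i + n = 0 then 2 * of_real pi else 0))"
proof -
  have "(LINT x:{-pi..pi}|lborel. (\<Sum>i\<in>S. c i * exp (\<i> * of_real x * of_int (\<phi> i))) * exp (\<i> * of_real x * of_int n)) =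
    (LINT x:{-pi..pi}|lborel. (\<Sum>i\<in>S. c i * exp (\<i> * of_real x * of_int (\<phi> i + n))))"
    by (simp add: sum_distrib_right sum_distrib_left exp_add[symmetric] algebra_simps)
  also have "\<dots> = (\<Sum>i\<in>S. LINT x:{-pi..pi}|lborel. c i * exp (\<i> * of_real x * of_int (\<phi> i + n)))"
    unfolding set_lebesgue_integral_def scaleR_sum_right
    by (rule Bochner_Integration.integral_sum)
      (rule borel_integrable_atLeastAtMost'[unfolded set_integrable_def], intro continuous_intros)
  also have "\<dots> = (\<Sum>i\<in>S. c i * (if \<phi> i + n = 0 then 2 * of_real pi else 0))"
    by (simp only: set_integral_mult_right set_integral_exp_int)
  finally show ?thesis .
qed

text \<open>Poisson summation for trigonometric polynomials.\<close>

lemma sum_fourier_coefficients_trig_poly: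
  fixes c :: "'i \<Rightarrow> complex" and \<phi> :: "'i \<Rightarrow> int"
  assumes "finite S" and "p > 0" and bound: "\<And>i. i \<in> S \<Longrightarrow> \<bar>\<phi> i\<bar> \<le> K"
  defines "T \<equiv> \<lambda>x. \<Sum>i\<in>S. c i * exp (\<i> * of_real x * of_int (\<phi> i))"
  shows "(\<Sum>j\<in>{-K..K}. LINT x:{-pi..pi}|lborel. T x * exp (\<i> * of_real x * of_int (j * int p))) =
    2 * of_real pi / of_nat p * (\<Sum>m<p. T (2 * pi * real m / real p))"
proof -
  \<comment> \<open>For a fixed frequency at most one \<open>j\<close> contributes, namely the
    negative of the quotient of \<open>\<phi> i\<close> by \<open>p\<close>; the bound
    \<open>K\<close> keeps it inside the summation window.\<close>
  have inner: "(\<Sum>j\<in>{-K..K}. if \<phi> i + j * int p = 0 then 2 * of_real pi else 0) =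
      (if int p dvd \<phi> i then 2 * of_real pi else (0::complex))" if "i \<in> S" for i
  proof (cases "int p dvd \<phi> i")
    case True
    then obtain q where q: "\<phi> i = int p * q" by auto
    have "\<bar>q\<bar> \<le> \<bar>\<phi> i\<bar>"
      using \<open>p > 0\<close> mult_right_mono[of 1 "int p" "\<bar>q\<bar>"] unfolding q abs_mult by simp
    then have "-q \<in> {-K..K}" using bound[OF that] by auto
    moreover have "\<phi> i + j * int p = 0 \<longleftrightarrow> j = -q" for j
    proof -
      have "\<phi> i + j * int p = int p * (q + j)" by (simp add: q algebra_simps)
      then show ?thesis using \<open>p > 0\<close> by auto
    qed
    ultimately show ?thesis using True by (simp add: sum.delta)
  next
    case False
    then have "\<phi> i + j * int p \<noteq> 0" for j
      by (metis dvd_add_times_triv_right_iff dvd_0_right)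
    with False show ?thesis by simp
  qed
  have "(\<Sum>j\<in>{-K..K}. LINT x:{-pi..pi}|lborel. T x * exp (\<i> * of_real x * of_int (j * int p))) =
    (\<Sum>j\<in>{-K..K}. \<Sum>i\<in>S. c i * (if \<phi> i + j * int p = 0 then 2 * of_real pi else 0))"
    unfolding T_def by (simp only: fourier_coefficient_trig_poly[OF \<open>finite S\<close>])
  also have "\<dots> = (\<Sum>i\<in>S. c i * (\<Sum>j\<in>{-K..K}. if \<phi> i + j * int p = 0 then 2 * of_real pi else 0))"
    unfolding sum_distrib_left by (rule sum.swap)
  also have "\<dots> = (\<Sum>i\<in>S. c i * (if int p dvd \<phi> i then 2 * of_real pi else 0))"
    by (intro sum.cong refl) (simp only: inner)
  \<comment> \<open>The divisibility condition is turned back into an average of characters at the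
    \<open>p\<close>-th roots of unity, which reassembles \<open>T\<close> at the sample
    points.\<close>
  also have "\<dots> = (\<Sum>i\<in>S. c i * (2 * of_real pi / of_nat p *
      (\<Sum>m<p. exp (\<i> * of_real (2 * pi * real m / real p) * of_int (\<phi> i)))))"
    unfolding sum_exp_roots[OF \<open>p > 0\<close>] using \<open>p > 0\<close> by (intro sum.cong refl) auto
  also have "\<dots> = 2 * of_real pi / of_nat p * (\<Sum>m<p. T (2 * pi * real m / real p))"
    unfolding T_def sum_distrib_left by (subst sum.swap) (simp add: algebra_simps)
  finally show ?thesis .
qed

text \<open>The squared modulus is the product with the conjugate, and conjugation inverts a point
  of the unit circle. Two binomial expansions then give a trigonometric polynomial in
  \<open>x\<close> with frequencies \<open>s - t\<close>, bounded by \<open>k\<close>; the other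
  variables are confined to \<open>a\<close>.\<close>

lemma norm_exp_add_power:
  "of_real (cmod (exp (\<i> * of_real x) + a) ^ (2 * k)) =
    (\<Sum>(s, t)\<in>{..k} \<times> {..k}. of_nat (k choose s) * of_nat (k choose t) * a ^ (k - s) * cnj a ^ (k - t) *
      exp (\<i> * of_real x * of_int (int s - int t)))"
proof -
  let ?e = "exp (\<i> * of_real x)"
  have cnj: "cnj ?e = exp (- (\<i> * of_real x))"
    by (simp add: exp_cnj)
  have "of_real (cmod (?e + a) ^ (2 * k)) = (?e + a) ^ k * (exp (- (\<i> * of_real x)) + cnj a) ^ k"
    using complex_norm_square[of "?e + a"]
    by (simp add: power_mult cnj power_mult_distrib)
  also have "\<dots> = (\<Sum>s\<le>k. \<Sum>t\<le>k. (of_nat (k choose s) * ?e ^ s * a ^ (k - s)) *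
      (of_nat (k choose t) * exp (- (\<i> * of_real x)) ^ t * cnj a ^ (k - t)))"
    unfolding binomial_ring sum_product ..
  also have "\<dots> = (\<Sum>s\<le>k. \<Sum>t\<le>k. of_nat (k choose s) * of_nat (k choose t) * a ^ (k - s) * cnj a ^ (k - t) *
      exp (\<i> * of_real x * of_int (int s - int t)))"
  proof (intro sum.cong refl)
    fix s t
    have "exp (\<i> * of_real x * of_int (int s - int t)) = ?e ^ s * exp (- (\<i> * of_real x)) ^ t"
      unfolding exp_of_nat_mult[symmetric] exp_add[symmetric] by (simp add: algebra_simps)
    then show "(of_nat (k choose s) * ?e ^ s * a ^ (k - s)) *
      (of_nat (k choose t) * exp (- (\<i> * of_real x)) ^ t * cnj a ^ (k - t)) =
      of_nat (k choose s) * of_nat (k choose t) * a ^ (k - s) * cnj a ^ (k - t) *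
      exp (\<i> * of_real x * of_int (int s - int t))"
      by (simp add: mult_ac)
  qed
  finally show ?thesis by (simp only: sum.cartesian_product)
qed

section \<open>The moments\<close>

lemma set_integral_even:
  fixes f :: "real \<Rightarrow> 'a::euclidean_space"
  assumes cont: "continuous_on {-a..a} f" and even: "\<And>x. f (- x) = f x" and "a \<ge> 0"
  shows "(LINT x:{-a..a}|lborel. f x) = 2 *\<^sub>R (LINT x:{0..a}|lborel. f x)"
proof -
  have int: "set_integrable lborel {-a..0} f" "set_integrable lborel {0..a} f"
    using \<open>a \<ge> 0\<close> by (auto intro!: borel_integrable_atLeastAtMost' continuous_on_subset[OF cont])
  have "(LINT x:{-a..0}|lborel. f x) = (LINT x:{0..a}|lborel. f x)"
    by (subst set_integral_reflect)
      (auto simp: even atLeastAtMost_def atLeast_def atMost_def intro!: arg_cong2[where f="set_lebesgue_integral lborel"])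
  moreover have "(LINT x:{-a..0} \<union> {0..a}|lborel. f x) = (LINT x:{-a..0}|lborel. f x) + (LINT x:{0..a}|lborel. f x)"
  proof (rule set_integral_Un_AE)
    show "AE x in lborel. \<not> (x \<in> {-a..0} \<and> x \<in> {0..a})"
      using AE_lborel_singleton[of "0::real"] by eventually_elim auto
  qed (use int in auto)
  moreover have "{-a..0} \<union> {0..a} = {-a..a}"
    using \<open>a \<ge> 0\<close> by auto
  ultimately show ?thesis by (simp add: scaleR_2)
qed

lemma set_integral_finite_sum:
  fixes f :: "'i \<Rightarrow> real \<Rightarrow> 'a::euclidean_space"
  assumes "\<And>i. i \<in> S \<Longrightarrow> continuous_on {a..b} (f i)"
  shows "(LINT x:{a..b}|lborel. \<Sum>i\<in>S. f i x) = (\<Sum>i\<in>S. LINT x:{a..b}|lborel. f i x)"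
  unfolding set_lebesgue_integral_def scaleR_sum_right
  by (rule Bochner_Integration.integral_sum)
    (rule borel_integrable_atLeastAtMost'[unfolded set_integrable_def], rule assms)

text \<open>Law of cosines: \<open>exp (i \<theta>) + 1\<close> is the vector of signed length
  \<open>2 * cos (\<theta> / 2)\<close> in direction \<open>\<theta> / 2\<close>, to which a unit
  vector of angle \<open>v\<close> is added. The verification goes through real and imaginary
  parts.\<close>

lemma norm_exp_sum_square:
  "cmod (exp (\<i> * of_real \<theta>) + exp (\<i> * of_real v) + 1) ^ 2 =
    1 + (2 * cos (\<theta> / 2))\<^sup>2 + 2 * (2 * cos (\<theta> / 2)) * cos (v - \<theta> / 2)"
proof -
  define c s where "c = cos (\<theta> / 2)" and "s = sin (\<theta> / 2)"
  have cs: "s\<^sup>2 = 1 - c\<^sup>2" and v: "(sin v)\<^sup>2 = 1 - (cos v)\<^sup>2"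
    unfolding c_def s_def by (simp_all add: sin_squared_eq)
  have c2: "cos \<theta> = 2 * c\<^sup>2 - 1" "sin \<theta> = 2 * s * c"
    using cos_double_cos[of "\<theta> / 2"] sin_double[of "\<theta> / 2"] unfolding c_def s_def by simp_all
  have "cmod (exp (\<i> * of_real \<theta>) + exp (\<i> * of_real v) + 1) ^ 2 = (cos \<theta> + cos v + 1)\<^sup>2 + (sin \<theta> + sin v)\<^sup>2"
    by (simp add: cmod_power2 Re_exp Im_exp)
  also have "\<dots> = (2 * c\<^sup>2 + cos v)\<^sup>2 + (2 * s * c + sin v)\<^sup>2"
    by (simp add: c2)
  also have "\<dots> = 4 * c\<^sup>2 * (c\<^sup>2 + s\<^sup>2) + ((cos v)\<^sup>2 + (sin v)\<^sup>2) + 4 * c * (c * cos v + s * sin v)"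
    by (simp add: power2_eq_square algebra_simps)
  also have "\<dots> = 1 + (2 * c)\<^sup>2 + 2 * (2 * c) * cos (v - \<theta> / 2)"
    unfolding cs v cos_diff c_def[symmetric] s_def[symmetric] by (simp add: power_mult_distrib mult_ac)
  finally show ?thesis unfolding c_def .
qed

text \<open>A shift of \<open>v\<close> over the full period absorbs both the phase
  \<open>\<theta> / 2\<close> and the sign of the cosine; evenness then folds the integral onto
  \<open>[0, pi]\<close>.\<close>

lemma set_integral_norm_exp_sum:
  fixes \<theta> :: real
  defines "r \<equiv> 2 * \<bar>cos (\<theta> / 2)\<bar>"
  shows "(LINT v:{-pi..pi}|lborel. complex_of_real (cmod (exp (\<i> * of_real \<theta>) + exp (\<i> * of_real v) + 1) ^ (2 * k))) =
    of_real (2 * (LINT v:{0..pi}|lborel. (1 + r\<^sup>2 - 2 * r * cos v) ^ k))"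
proof -
  define f where "f = (\<lambda>v. complex_of_real ((1 + r\<^sup>2 - 2 * r * cos v) ^ k))"
  \<comment> \<open>When the cosine is nonnegative, the extra shift by \<open>pi\<close> flips the
    sign of the cross term, so that it is \<open>- 2 * r * cos (v - w)\<close> with
    \<open>r \<ge> 0\<close> in both cases. The minus sign makes the integrand's base nondecreasing
    on \<open>[0, pi]\<close>.\<close>
  define w where "w = (if cos (\<theta> / 2) \<ge> 0 then \<theta> / 2 - pi else \<theta> / 2)"
  have cont: "continuous_on A f" for A
    unfolding f_def by (intro continuous_intros)
  have "2 * (2 * cos (\<theta> / 2)) * cos (v - \<theta> / 2) = - (2 * r * cos (v - w))" for v
    by (simp add: w_def r_def cos_diff algebra_simps)
  then have "cmod (exp (\<i> * of_real \<theta>) + exp (\<i> * of_real v) + 1) ^ 2 = 1 + r\<^sup>2 - 2 * r * cos (v - w)" for v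
    unfolding norm_exp_sum_square by (simp add: r_def power_mult_distrib)
  then have "complex_of_real (cmod (exp (\<i> * of_real \<theta>) + exp (\<i> * of_real v) + 1) ^ (2 * k)) = f (v - w)" for v
    unfolding f_def power_mult by (simp only:)
  then have "(LINT v:{-pi..pi}|lborel. complex_of_real (cmod (exp (\<i> * of_real \<theta>) + exp (\<i> * of_real v) + 1) ^ (2 * k))) =
      (LINT v:{-pi..pi}|lborel. f (v - w))"
    by simp
  also have "\<dots> = (LINT v:{-pi..pi}|lborel. f v)"
    by (rule periodic_set_integral_shift[OF cont]) (simp add: f_def)
  also have "\<dots> = 2 * (LINT v:{0..pi}|lborel. f v)"
    by (subst set_integral_even[OF cont]) (simp_all add: f_def scaleR_conv_of_real)
  finally show ?thesis
    unfolding f_def set_integral_complex_of_real by simp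
qed

text \<open>For \<open>q = 0\<close> the integrand depends on \<open>u = x - z\<close> and
  \<open>v = y - z\<close> only, and the character on \<open>u\<close> alone. Periodicity decouples
  the three integrals, Poisson summation in \<open>u\<close> replaces the sum over \<open>j\<close>
  by samples, and the integral in \<open>v\<close> is the one just computed.\<close>

lemma dual_nanotube_moment_zigzag:
  assumes "p > 0"
  shows "dual_nanotube_moment p 0 k =
    of_real ((\<Sum>m<p. (LINT v:{0..pi}|lborel.
      (1 + (2 * \<bar>cos (pi * real m / real p)\<bar>)\<^sup>2 - 2 * (2 * \<bar>cos (pi * real m / real p)\<bar>) * cos v) ^ k) / pi) / real p)"
proof -
  define N where "N = (\<lambda>u v. complex_of_real (cmod (exp (\<i> * of_real u) + (exp (\<i> * of_real v) + 1)) ^ (2 * k)))"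
  \<comment> \<open>Unnormalised Fourier coefficient of \<open>N\<close> in the first variable at
    frequency \<open>- j * p\<close>, as a function of the second.\<close>
  define K where "K = (\<lambda>j v. LINT u:{-pi..pi}|lborel. N u v * exp (\<i> * of_real u * of_int (j * int p)))"
  define c where "c = (\<lambda>v (s, t). of_nat (k choose s) * of_nat (k choose t) *
    (exp (\<i> * of_real v) + 1) ^ (k - s) * cnj (exp (\<i> * of_real v) + 1) ^ (k - t))"
  define \<phi> where "\<phi> = (\<lambda>(s, t). int s - int t)"
  define S where "S = {..k} \<times> {..k}"
  have S: "finite S" "\<And>i. i \<in> S \<Longrightarrow> \<bar>\<phi> i\<bar> \<le> int k"
    by (auto simp: S_def \<phi>_def)
  have N_eq: "N u v = (\<Sum>i\<in>S. c v i * exp (\<i> * of_real u * of_int (\<phi> i)))" for u v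
    unfolding N_def norm_exp_add_power c_def \<phi>_def S_def by (intro sum.cong refl) auto
  have contN: "continuous_on A (\<lambda>u. N u v)" "continuous_on A (N u)" for A u v
    unfolding N_def by (intro continuous_intros)+
  \<comment> \<open>The closed form gives both continuity in \<open>v\<close> and vanishing for
    large \<open>j\<close>.\<close>
  have K_eq: "K j v = (\<Sum>i\<in>S. c v i * (if \<phi> i + j * int p = 0 then 2 * of_real pi else 0))" for j v
    unfolding K_def N_eq by (rule fourier_coefficient_trig_poly[OF S(1)])
  have contK: "continuous_on A (K j)" for A j
  proof -
    have "continuous_on A (\<lambda>v. c v i)" for i
      unfolding c_def by (cases i) (auto intro!: continuous_intros)
    then show ?thesis unfolding K_eq by (intro continuous_intros)
  qed
  have exp_per: "exp (\<i> * of_real (x + 2 * pi)) = exp (\<i> * of_real x)" for x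
    unfolding exp_eq by (intro exI[of _ 1]) (simp add: algebra_simps)
  \<comment> \<open>All frequencies of \<open>N\<close> in \<open>u\<close> have absolute value at
    most \<open>k\<close>, while \<open>j * p\<close> exceeds \<open>k\<close> in absolute value;
    hence the infinite sum is finite.\<close>
  have K_0: "K j v = 0" if "j \<notin> {- int k..int k}" for j v
  proof -
    have "\<phi> i + j * int p \<noteq> 0" if "i \<in> S" for i
    proof -
      have "\<bar>j\<bar> \<le> \<bar>j * int p\<bar>"
        using \<open>p > 0\<close> mult_left_mono[of 1 "int p" "\<bar>j\<bar>"] by (simp add: abs_mult)
      moreover have "int k < \<bar>j\<bar>" using \<open>j \<notin> _\<close> by auto
      ultimately show ?thesis using S(2)[OF that] by linarith
    qed
    then show ?thesis unfolding K_eq by (intro sum.neutral) auto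
  qed

  have inner: "(LINT x:{-pi..pi}|lborel.
      of_real (cmod (exp (\<i> * of_real x) + exp (\<i> * of_real y) + exp (\<i> * of_real z)) ^ (2 * k)) *
      exp (\<i> * of_real (real_of_int j * (real p * (x - z) + real 0 * (y - z))))) = K j (y - z)" for j y z
  proof -
    define f where "f = (\<lambda>u. N u (y - z) * exp (\<i> * of_real u * of_int (j * int p)))"
    \<comment> \<open>Factoring out the unimodular number \<open>exp (i z)\<close> leaves only
      differences of angles.\<close>
    have rot: "cmod (exp (\<i> * of_real x) + exp (\<i> * of_real y) + exp (\<i> * of_real z)) =
        cmod (exp (\<i> * of_real (x - z)) + (exp (\<i> * of_real (y - z)) + 1))" for x
    proof -
      have "exp (\<i> * of_real x) + exp (\<i> * of_real y) + exp (\<i> * of_real z) =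
          exp (\<i> * of_real z) * (exp (\<i> * of_real (x - z)) + (exp (\<i> * of_real (y - z)) + 1))"
        by (simp add: distrib_left exp_add[symmetric] algebra_simps)
      then show ?thesis by (simp add: norm_mult)
    qed
    have "(LINT x:{-pi..pi}|lborel.
      of_real (cmod (exp (\<i> * of_real x) + exp (\<i> * of_real y) + exp (\<i> * of_real z)) ^ (2 * k)) *
      exp (\<i> * of_real (real_of_int j * (real p * (x - z) + real 0 * (y - z))))) =
      (LINT x:{-pi..pi}|lborel. f (x - z))"
      unfolding f_def N_def rot by (simp add: mult_ac)
    also have "\<dots> = (LINT x:{-pi..pi}|lborel. f x)"
    proof (rule periodic_set_integral_shift)
      show "continuous_on UNIV f"
        unfolding f_def by (intro continuous_intros contN)
      show "f (x + 2 * pi) = f x" for x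
      proof -
        have "exp (\<i> * of_real (x + 2 * pi) * of_int n) = exp (\<i> * of_real x * of_int n)" for n
          unfolding exp_eq by (intro exI[of _ n]) (simp add: algebra_simps)
        then show ?thesis unfolding f_def N_def exp_per by (simp only:)
      qed
    qed
    finally show ?thesis unfolding f_def K_def .
  qed
  have middle: "(LINT y:{-pi..pi}|lborel. K j (y - z)) = (LINT y:{-pi..pi}|lborel. K j y)" for j z
  proof (rule periodic_set_integral_shift[OF contK])
    show "K j (x + 2 * pi) = K j x" for x
      unfolding K_def N_def exp_per ..
  qed
  have outer: "(LINT z:{-pi..pi}|lborel. C) = 2 * of_real pi * C" for C :: complex
    by (simp add: set_integral_const scaleR_conv_of_real)

  have "(\<Sum>\<^sub>\<infinity>j. 2 * of_real pi * (LINT v:{-pi..pi}|lborel. K j v)) =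
      (\<Sum>\<^sub>\<infinity>j\<in>{- int k..int k}. 2 * of_real pi * (LINT v:{-pi..pi}|lborel. K j v))"
    by (rule infsum_cong_neutral) (auto simp: K_0)
  also have "\<dots> = 2 * of_real pi * (\<Sum>j\<in>{- int k..int k}. LINT v:{-pi..pi}|lborel. K j v)"
    by (simp add: sum_distrib_left)
  also have "(\<Sum>j\<in>{- int k..int k}. LINT v:{-pi..pi}|lborel. K j v) = (LINT v:{-pi..pi}|lborel. \<Sum>j\<in>{- int k..int k}. K j v)"
    by (rule set_integral_finite_sum[symmetric]) (rule contK)
  also have "\<dots> = (LINT v:{-pi..pi}|lborel. 2 * of_real pi / of_nat p * (\<Sum>m<p. N (2 * pi * real m / real p) v))"
    unfolding K_def N_eq
    by (subst sum_fourier_coefficients_trig_poly[OF S(1) \<open>p > 0\<close> S(2)]) auto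
  also have "\<dots> = 2 * of_real pi / of_nat p * (\<Sum>m<p. LINT v:{-pi..pi}|lborel. N (2 * pi * real m / real p) v)"
    by (simp only: set_integral_mult_right set_integral_finite_sum[OF contN(2)])
  also have "(\<Sum>m<p. LINT v:{-pi..pi}|lborel. N (2 * pi * real m / real p) v) =
      (\<Sum>m<p. of_real (2 * (LINT v:{0..pi}|lborel.
      (1 + (2 * \<bar>cos (pi * real m / real p)\<bar>)\<^sup>2 - 2 * (2 * \<bar>cos (pi * real m / real p)\<bar>) * cos v) ^ k)))"
    unfolding N_def add.assoc[symmetric] set_integral_norm_exp_sum by (simp add: mult.assoc)
  \<comment> \<open>The constants combine as \<open>2 pi\<close> from \<open>z\<close>,
    \<open>2 pi / p\<close> from Poisson summation and 2 from folding, divided by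
    \<open>(2 pi) ^ 3\<close>, that is, \<open>1 / (p * pi)\<close>.\<close>
  finally show ?thesis
    unfolding dual_nanotube_moment_def inner middle outer
    by (simp add: sum_divide_distrib[symmetric] sum_distrib_left[symmetric] power3_eq_cube)
qed

section \<open>The moment problem for bounded random variables\<close>

text \<open>The Taylor remainder of the characteristic function after order \<open>n\<close> is at
  most \<open>2 * \<bar>t\<bar> ^ n / fact n\<close> times the \<open>n\<close>-th absolute moment.
  Boundedness replaces that moment by \<open>B ^ n\<close>, and the factorial wins.\<close>

lemma (in prob_space) char_distr_moment_series:
  fixes X :: "'a \<Rightarrow> real"
  assumes X[measurable]: "random_variable borel X" and bound: "AE \<omega> in M. \<bar>X \<omega>\<bar> \<le> B"
  shows "(\<lambda>n. \<Sum>k\<le>n. (\<i> * of_real t) ^ k / fact k * of_real (expectation (\<lambda>\<omega>. X \<omega> ^ k)))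
    \<longlonglongrightarrow> char (distr M borel X) t"
proof -
  have int: "integrable M (\<lambda>\<omega>. X \<omega> ^ k)" and int_abs: "integrable M (\<lambda>\<omega>. \<bar>X \<omega>\<bar> ^ k)" for k
  proof -
    have "AE \<omega> in M. norm (X \<omega> ^ k) \<le> B ^ k"
      using bound by eventually_elim (simp add: power_abs power_mono)
    then show "integrable M (\<lambda>\<omega>. X \<omega> ^ k)" "integrable M (\<lambda>\<omega>. \<bar>X \<omega>\<bar> ^ k)"
      by (auto intro!: integrable_const_bound[where B="B ^ k"] simp: power_abs)
  qed
  let ?S = "\<lambda>n. \<Sum>k\<le>n. (\<i> * of_real t) ^ k / fact k * of_real (expectation (\<lambda>\<omega>. X \<omega> ^ k))"
  have bnd: "cmod (?S n - char (distr M borel X) t) \<le> 2 * (inverse (fact n) * (\<bar>t\<bar> * B) ^ n)" for n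
  proof -
    have "expectation (\<lambda>\<omega>. \<bar>X \<omega>\<bar> ^ n) \<le> expectation (\<lambda>\<omega>. B ^ n)"
    proof (intro integral_mono_AE int_abs integrable_const)
      show "AE \<omega> in M. \<bar>X \<omega>\<bar> ^ n \<le> B ^ n"
        using bound by eventually_elim (simp add: power_mono)
    qed
    then have "2 * \<bar>t\<bar> ^ n / fact n * expectation (\<lambda>\<omega>. \<bar>X \<omega>\<bar> ^ n) \<le> 2 * \<bar>t\<bar> ^ n / fact n * B ^ n"
      by (intro mult_left_mono) (auto simp: prob_space)
    also have "2 * \<bar>t\<bar> ^ n / fact n * B ^ n = 2 * (inverse (fact n) * (\<bar>t\<bar> * B) ^ n)"
      by (simp add: power_mult_distrib divide_inverse)
    finally show ?thesis
      unfolding norm_minus_commute[of "?S n"] by (rule order_trans[OF char_approx1'[OF int X refl]])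
  qed
  have "(\<lambda>n. 2 * (inverse (fact n) * (\<bar>t\<bar> * B) ^ n)) \<longlonglongrightarrow> 0"
    by (rule tendsto_mult_right_zero[OF summable_LIMSEQ_zero[OF summable_exp]])
  then have "(\<lambda>n. ?S n - char (distr M borel X) t) \<longlonglongrightarrow> 0"
    by (rule Lim_null_comparison[rotated]) (use bnd in simp)
  then show ?thesis by (rule LIM_zero_cancel)
qed

text \<open>Both characteristic functions are limits of the same sequence, so they agree and Levy's
  uniqueness theorem applies.\<close>

lemma distr_eq_if_bounded_moments_eq:
  fixes X :: "'a \<Rightarrow> real" and Y :: "'b \<Rightarrow> real"
  assumes "prob_space M" "prob_space N"
    and X: "X \<in> borel_measurable M" "AE \<omega> in M. \<bar>X \<omega>\<bar> \<le> B"
    and Y: "Y \<in> borel_measurable N" "AE \<omega> in N. \<bar>Y \<omega>\<bar> \<le> C"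
    and moments: "\<And>k. (\<integral>\<omega>. X \<omega> ^ k \<partial>M) = (\<integral>\<omega>. Y \<omega> ^ k \<partial>N)"
  shows "distr M borel X = distr N borel Y"
proof (rule Levy_uniqueness)
  show "real_distribution (distr M borel X)" "real_distribution (distr N borel Y)"
    using assms by (auto intro: prob_space.real_distribution_distr)
  show "char (distr M borel X) = char (distr N borel Y)"
  proof
    fix t
    show "char (distr M borel X) t = char (distr N borel Y) t"
      using prob_space.char_distr_moment_series[OF \<open>prob_space M\<close> X, of t]
        prob_space.char_distr_moment_series[OF \<open>prob_space N\<close> Y, of t]
      unfolding moments by (rule LIMSEQ_unique)
  qed
qed

section \<open>The mixture of arcsine laws\<close>

text \<open>A concrete space for the independent pair \<open>(m, v)\<close>, on which the law of the
  eigenvalue can be computed once the moments are matched.\<close>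

definition zigzag_model :: "nat \<Rightarrow> (nat \<times> real) measure" where
  "zigzag_model p = measure_pmf (pmf_of_set {..<p}) \<Otimes>\<^sub>M uniform_measure lborel {0..pi}"

text \<open>The modulus of \<open>1 + exp (2 pi i m / p)\<close>.\<close>

definition zigzag_radius :: "nat \<Rightarrow> nat \<Rightarrow> real" where
  "zigzag_radius p m = 2 * \<bar>cos (pi * real m / real p)\<bar>"

text \<open>The squared distance from the point of angle \<open>v\<close> on the unit circle to the
  real number \<open>zigzag_radius p m\<close>.\<close>

definition zigzag_value :: "nat \<Rightarrow> nat \<times> real \<Rightarrow> real" where
  "zigzag_value p = (\<lambda>(m, v). 1 + (zigzag_radius p m)\<^sup>2 - 2 * zigzag_radius p m * cos v)"

lemma prob_space_uniform_pi: "prob_space (uniform_measure lborel {0..pi})"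
  by (rule prob_space_uniform_measure) simp_all

lemma pair_prob_space_zigzag_model:
  "pair_prob_space (measure_pmf (pmf_of_set {..<p})) (uniform_measure lborel {0..pi})"
  unfolding pair_prob_space_def pair_sigma_finite_def
  by (simp add: measure_pmf.prob_space_axioms prob_space_uniform_pi
      measure_pmf.sigma_finite_measure_axioms prob_space_imp_sigma_finite)

lemma prob_space_zigzag_model: "prob_space (zigzag_model p)"
proof -
  interpret pair_prob_space "measure_pmf (pmf_of_set {..<p})" "uniform_measure lborel {0..pi}"
    by (rule pair_prob_space_zigzag_model)
  show ?thesis unfolding zigzag_model_def by (rule P.prob_space_axioms)
qed

lemma measurable_zigzag_value [measurable]: "zigzag_value p \<in> borel_measurable (zigzag_model p)"
proof -
  have [measurable]: "zigzag_radius p \<in> borel_measurable (measure_pmf (pmf_of_set {..<p}))"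
    by simp
  show ?thesis
    unfolding zigzag_value_def zigzag_model_def by measurable
qed

text \<open>The radius lies in \<open>[0, 2]\<close>, so the three terms contribute at most 1 + 4 +
  4.\<close>

lemma abs_zigzag_value_le: "\<bar>zigzag_value p \<omega>\<bar> \<le> 9"
proof (cases \<omega>)
  case (Pair m v)
  let ?r = "zigzag_radius p m"
  have r: "0 \<le> ?r" "?r \<le> 2"
    by (auto simp: zigzag_radius_def)
  have "\<bar>?r * cos v\<bar> \<le> 2 * 1"
    unfolding abs_mult using r by (intro mult_mono) auto
  moreover have "?r\<^sup>2 \<le> 4"
    using power_mono[OF r(2) r(1), of 2] by simp
  moreover have "0 \<le> ?r\<^sup>2" by simp
  ultimately show ?thesis unfolding zigzag_value_def Pair prod.case mult.assoc by linarith
qed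

lemma integral_uniform_pi:
  fixes f :: "real \<Rightarrow> real"
  assumes [measurable]: "f \<in> borel_measurable borel"
  shows "(\<integral>v. f v \<partial>uniform_measure lborel {0..pi}) = (LINT v:{0..pi}|lborel. f v) / pi"
proof -
  have "uniform_measure lborel {0..pi} = density lborel (\<lambda>v. ennreal (indicator {0..pi} v / pi))"
    unfolding uniform_measure_def
    by (intro density_cong) (auto simp: divide_ennreal ennreal_indicator[symmetric])
  then show ?thesis
    by (simp add: integral_real_density set_lebesgue_integral_def mult.commute)
qed

text \<open>Fubini, brought to the shape of \<open>dual_nanotube_moment_zigzag\<close> for
  comparison.\<close>

lemma zigzag_value_moment:
  assumes "p > 0"
  shows "(\<integral>\<omega>. zigzag_value p \<omega> ^ k \<partial>zigzag_model p) =
    (\<Sum>m<p. (LINT v:{0..pi}|lborel. zigzag_value p (m, v) ^ k) / pi) / real p"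
proof -
  interpret pair_prob_space "measure_pmf (pmf_of_set {..<p})" "uniform_measure lborel {0..pi}"
    by (rule pair_prob_space_zigzag_model)
  have "integrable (zigzag_model p) (\<lambda>\<omega>. zigzag_value p \<omega> ^ k)"
  proof (rule finite_measure.integrable_const_bound)
    show "finite_measure (zigzag_model p)"
      using prob_space_zigzag_model by (rule prob_space.finite_measure)
    show "AE \<omega> in zigzag_model p. norm (zigzag_value p \<omega> ^ k) \<le> 9 ^ k"
      by (simp add: power_abs power_mono abs_zigzag_value_le)
  qed measurable
  then have "(\<integral>\<omega>. zigzag_value p \<omega> ^ k \<partial>zigzag_model p) =
      (\<integral>m. (\<integral>v. zigzag_value p (m, v) ^ k \<partial>uniform_measure lborel {0..pi}) \<partial>measure_pmf (pmf_of_set {..<p}))"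
    unfolding zigzag_model_def by (rule integral_fst'[symmetric])
  also have "\<dots> = (\<integral>m. (LINT v:{0..pi}|lborel. zigzag_value p (m, v) ^ k) / pi \<partial>measure_pmf (pmf_of_set {..<p}))"
    by (subst integral_uniform_pi) (simp_all add: zigzag_value_def)
  also have "\<dots> = (\<Sum>m<p. (LINT v:{0..pi}|lborel. zigzag_value p (m, v) ^ k) / pi) / real p"
    using assms by (subst integral_pmf_of_set) auto
  finally show ?thesis .
qed

text \<open>Tonelli writes the law as the average of its conditional laws given \<open>m\<close>,
  which are then identified one at a time.\<close>

lemma emeasure_distr_zigzag_value:
  assumes "p > 0" and A[measurable]: "A \<in> sets borel"
  shows "emeasure (distr (zigzag_model p) borel (zigzag_value p)) A =
    (\<Sum>m<p. (\<integral>\<^sup>+v. indicator A (zigzag_value p (m, v)) * indicator {0..pi} v \<partial>lborel) / ennreal pi) / of_nat p"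
proof -
  interpret pair_prob_space "measure_pmf (pmf_of_set {..<p})" "uniform_measure lborel {0..pi}"
    by (rule pair_prob_space_zigzag_model)
  have "emeasure (distr (zigzag_model p) borel (zigzag_value p)) A =
      (\<integral>\<^sup>+\<omega>. indicator A (zigzag_value p \<omega>) \<partial>zigzag_model p)"
    by (subst nn_integral_indicator[symmetric], simp, subst nn_integral_distr) auto
  also have "\<dots> = (\<integral>\<^sup>+m. (\<integral>\<^sup>+v. indicator A (zigzag_value p (m, v)) \<partial>uniform_measure lborel {0..pi})
      \<partial>measure_pmf (pmf_of_set {..<p}))"
    unfolding zigzag_model_def
    by (rule M2.nn_integral_fst[symmetric]) (simp add: zigzag_model_def[symmetric])
  also have "\<dots> = (\<integral>\<^sup>+m. (\<integral>\<^sup>+v. indicator A (zigzag_value p (m, v)) * indicator {0..pi} v \<partial>lborel) / ennreal pi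
      \<partial>measure_pmf (pmf_of_set {..<p}))"
    by (subst nn_integral_uniform_measure) (simp_all add: zigzag_value_def)
  also have "\<dots> = (\<Sum>m<p. (\<integral>\<^sup>+v. indicator A (zigzag_value p (m, v)) * indicator {0..pi} v \<partial>lborel) / ennreal pi) / of_nat p"
    using assms by (subst nn_integral_pmf_of_set) (auto simp: lessThan_empty_iff)
  finally show ?thesis .
qed

text \<open>Substitute \<open>x = 1 + r\<^sup>2 - 2 * r * cos v\<close>, which increases on
  \<open>[0, pi]\<close> since \<open>r > 0\<close>. The square root of the radicand is exactly the
  Jacobian \<open>2 * r * sin v\<close>, so the two cancel.\<close>

lemma nn_integral_arcsine:
  fixes r :: real
  assumes "r > 0" and A[measurable]: "A \<in> sets borel"
  shows "(\<integral>\<^sup>+v. indicator A (1 + r\<^sup>2 - 2 * r * cos v) * indicator {0..pi} v \<partial>lborel) =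
    (\<integral>\<^sup>+x\<in>A. ennreal (indicator {(r - 1)\<^sup>2<..<(r + 1)\<^sup>2} x / sqrt (4 * r\<^sup>2 - (1 + r\<^sup>2 - x)\<^sup>2)) \<partial>lborel)"
proof -
  define g where "g = (\<lambda>v. 1 + r\<^sup>2 - 2 * r * cos v)"
  define f where "f = (\<lambda>x. indicator A x * (indicator {(r - 1)\<^sup>2<..<(r + 1)\<^sup>2} x / sqrt (4 * r\<^sup>2 - (1 + r\<^sup>2 - x)\<^sup>2)))"
  have g: "g 0 = (r - 1)\<^sup>2" "g pi = (r + 1)\<^sup>2"
    by (simp_all add: g_def power2_eq_square algebra_simps)
  have "(\<integral>\<^sup>+x. f x * indicator {g 0..g pi} x \<partial>lborel) =
      (\<integral>\<^sup>+v. f (g v) * (2 * r * sin v) * indicator {0..pi} v \<partial>lborel)"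
  proof (rule nn_integral_substitution)
    show "set_borel_measurable borel {g 0..g pi} f"
      unfolding set_borel_measurable_def f_def by measurable
    show "(g has_real_derivative 2 * r * sin x) (at x)" for x
      unfolding g_def by (auto intro!: derivative_eq_intros)
    show "0 \<le> 2 * r * sin x" if "x \<in> {0..pi}" for x
      using that \<open>r > 0\<close> sin_ge_zero[of x] by simp
  qed (auto intro!: continuous_intros)
  also have "\<dots> = (\<integral>\<^sup>+v. indicator A (g v) * indicator {0..pi} v \<partial>lborel)"
  proof (rule nn_integral_cong_AE)
    show "AE v in lborel. ennreal (f (g v) * (2 * r * sin v) * indicator {0..pi} v) = indicator A (g v) * indicator {0..pi} v"
      \<comment> \<open>At \<open>v = 0\<close> and \<open>v = pi\<close> the Jacobian is 0 and
        cannot be cancelled; these two points form a null set.\<close>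
      using AE_lborel_singleton[of 0] AE_lborel_singleton[of pi]
    proof eventually_elim
      case (elim v)
      show ?case
      proof (cases "v \<in> {0..pi}")
        case True
        with elim have v: "0 < v" "v < pi" by auto
        then have "0 < sin v" by (rule sin_gt_zero)
        have "cos v < 1" "- 1 < cos v"
          using v cos_monotone_0_pi[of 0 v] cos_monotone_0_pi[of v pi] by auto
        then have "g v \<in> {(r - 1)\<^sup>2<..<(r + 1)\<^sup>2}"
          using \<open>r > 0\<close> mult_strict_left_mono[of "cos v" 1 r] mult_strict_left_mono[of "-1" "cos v" r]
          by (simp add: g_def power2_eq_square algebra_simps)
        moreover have "4 * r\<^sup>2 - (1 + r\<^sup>2 - g v)\<^sup>2 = (2 * r * sin v)\<^sup>2"
          by (simp add: g_def power_mult_distrib sin_squared_eq algebra_simps)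
        ultimately have "f (g v) * (2 * r * sin v) = indicator A (g v)"
          using \<open>r > 0\<close> \<open>0 < sin v\<close> by (simp add: f_def real_sqrt_mult)
        with True show ?thesis by (simp add: ennreal_indicator)
      qed simp
    qed
  qed
  also have "(\<integral>\<^sup>+x. f x * indicator {g 0..g pi} x \<partial>lborel) =
      (\<integral>\<^sup>+x\<in>A. ennreal (indicator {(r - 1)\<^sup>2<..<(r + 1)\<^sup>2} x / sqrt (4 * r\<^sup>2 - (1 + r\<^sup>2 - x)\<^sup>2)) \<partial>lborel)"
    by (intro nn_integral_cong) (auto simp: f_def g indicator_def)
  finally show ?thesis unfolding g_def ..
qed

section \<open>Summands of the density and the degenerate index\<close>

definition zigzag_density_term :: "nat \<Rightarrow> nat \<Rightarrow> real \<Rightarrow> real" where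
  "zigzag_density_term p m x = indicator (zigzag_interval p m) x /
     sqrt (8 * (1 + cos (2 * pi * real m / real p)) - (3 + 2 * cos (2 * pi * real m / real p) - x)\<^sup>2)"

text \<open>By the double-angle formula \<open>r\<^sup>2 = 2 * (1 + cos (2 * pi * m / p))\<close>,
  which turns the trigonometric radicand into that of \<open>nn_integral_arcsine\<close>.\<close>

lemma zigzag_density_term_eq:
  fixes p m :: nat
  defines "r \<equiv> zigzag_radius p m"
  shows "zigzag_density_term p m x =
    indicator {(r - 1)\<^sup>2<..<(r + 1)\<^sup>2} x / sqrt (4 * r\<^sup>2 - (1 + r\<^sup>2 - x)\<^sup>2)"
proof -
  have "cos (2 * pi * real m / real p) = 2 * (cos (pi * real m / real p))\<^sup>2 - 1"
    using cos_double_cos[of "pi * real m / real p"] by (simp add: mult.assoc)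
  then show ?thesis
    unfolding zigzag_density_term_def zigzag_interval_def r_def zigzag_radius_def
    by (simp add: power_mult_distrib)
qed

text \<open>The radicand factors over the endpoints of the interval. The sign has to be checked
  because \<open>sqrt\<close> is extended to negative arguments as an odd function.\<close>

lemma zigzag_density_term_nonneg: "0 \<le> zigzag_density_term p m x"
proof (cases "x \<in> {(zigzag_radius p m - 1)\<^sup>2<..<(zigzag_radius p m + 1)\<^sup>2}")
  case True
  let ?r = "zigzag_radius p m"
  have "4 * ?r\<^sup>2 - (1 + ?r\<^sup>2 - x)\<^sup>2 = (x - (?r - 1)\<^sup>2) * ((?r + 1)\<^sup>2 - x)"
    by (simp add: power2_eq_square algebra_simps)
  also have "\<dots> \<ge> 0"
    using True by (intro mult_nonneg_nonneg) auto
  finally show ?thesis by (simp add: zigzag_density_term_eq)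
qed (simp add: zigzag_density_term_eq)

lemma measurable_zigzag_density_term [measurable]: "zigzag_density_term p m \<in> borel_measurable borel"
  unfolding zigzag_density_term_eq[abs_def] by measurable

lemma zigzag_density_eq_sum:
  assumes "p > 0"
  shows "zigzag_density p x = (\<Sum>m<p. zigzag_density_term p m x / pi) / real p"
proof -
  have "{0..p - 1} = {..<p}" using assms by auto
  then show ?thesis
    unfolding zigzag_density_def zigzag_density_term_def
    by (simp add: sum_divide_distrib mult_ac)
qed

lemma measurable_zigzag_density:
  assumes "p > 0"
  shows "zigzag_density p \<in> borel_measurable borel"
  unfolding zigzag_density_eq_sum[OF assms, abs_def] by measurable

lemma nn_integral_zigzag_density:
  assumes "p > 0" and A[measurable]: "A \<in> sets borel"
  shows "(\<integral>\<^sup>+x\<in>A. ennreal (zigzag_density p x) \<partial>lborel) =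
    (\<Sum>m<p. (\<integral>\<^sup>+x\<in>A. ennreal (zigzag_density_term p m x) \<partial>lborel) / ennreal pi) / of_nat p"
proof -
  have "ennreal (zigzag_density p x) * indicator A x =
      (\<Sum>m<p. ennreal (zigzag_density_term p m x) * indicator A x / ennreal pi) / of_nat p" for x
  proof -
    have "ennreal (zigzag_density p x) = (\<Sum>m<p. ennreal (zigzag_density_term p m x) / ennreal pi) / of_nat p"
    proof -
      have "ennreal (zigzag_density p x) = ennreal (\<Sum>m<p. zigzag_density_term p m x / pi) / ennreal (real p)"
        unfolding zigzag_density_eq_sum[OF \<open>p > 0\<close>] using \<open>p > 0\<close>
        by (intro divide_ennreal[symmetric] sum_nonneg) (auto simp: zigzag_density_term_nonneg)
      also have "ennreal (\<Sum>m<p. zigzag_density_term p m x / pi) = (\<Sum>m<p. ennreal (zigzag_density_term p m x) / ennreal pi)"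
        by (subst sum_ennreal[symmetric]) (simp_all add: zigzag_density_term_nonneg divide_ennreal)
      finally show ?thesis by (simp only: ennreal_of_nat_eq_real_of_nat)
    qed
    then show ?thesis
      by (simp add: indicator_def)
  qed
  then show ?thesis
    by (simp add: nn_integral_divide nn_integral_sum)
qed

text \<open>For \<open>m < p\<close> the angle lies in \<open>[0, pi]\<close>, where the cosine is
  injective and vanishes only at \<open>pi / 2\<close>.\<close>

lemma zigzag_radius_eq_0_iff:
  assumes "m < p"
  shows "zigzag_radius p m = 0 \<longleftrightarrow> 2 * m = p"
proof
  let ?x = "pi * (real m / real p)"
  assume "zigzag_radius p m = 0"
  then have "cos ?x = cos (pi / 2)"
    by (simp add: zigzag_radius_def)
  moreover have "?x \<le> pi * 1"
    using assms by (intro mult_left_mono) auto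
  ultimately have "?x = pi / 2"
    by - (rule cos_inj_pi, simp_all)
  then have "pi * (real m / real p) = pi * (1 / 2)"
    by simp
  then have "real m / real p = 1 / 2"
    by (simp only: mult_cancel_left pi_neq_zero simp_thms)
  then have "real (2 * m) = real p"
    using assms by (simp add: divide_eq_eq)
  then show "2 * m = p"
    by (simp only: of_nat_eq_iff)
next
  assume "2 * m = p"
  with assms have "pi * real m / real p = pi / 2"
    by auto
  then show "zigzag_radius p m = 0"
    by (simp only: zigzag_radius_def cos_pi_half abs_zero mult_zero_right)
qed

text \<open>For a positive radius this is the arcsine computation. For radius 0 the value is
  constantly 1, so integrating over \<open>[0, pi]\<close> and dividing by \<open>pi\<close> leaves
  a unit point mass.\<close>

lemma nn_integral_zigzag_value:
  assumes "m < p" and A[measurable]: "A \<in> sets borel"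
  shows "(\<integral>\<^sup>+v. indicator A (zigzag_value p (m, v)) * indicator {0..pi} v \<partial>lborel) / ennreal pi =
    (\<integral>\<^sup>+x\<in>A. ennreal (zigzag_density_term p m x) \<partial>lborel) / ennreal pi + (if 2 * m = p then indicator A 1 else 0)"
proof (cases "2 * m = p")
  case False
  then have "zigzag_radius p m > 0"
    using zigzag_radius_eq_0_iff[OF \<open>m < p\<close>] by (simp add: zigzag_radius_def)
  from nn_integral_arcsine[OF this A] False show ?thesis
    by (simp add: zigzag_density_term_eq zigzag_value_def)
next
  case True
  then have "zigzag_radius p m = 0"
    using zigzag_radius_eq_0_iff[OF \<open>m < p\<close>] by simp
  \<comment> \<open>At radius 0 both endpoints of the open interval equal 1, so it is empty.\<close>
  then have "zigzag_density_term p m = (\<lambda>_. 0)" "zigzag_value p (m, v) = 1" for v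
    by (simp_all add: zigzag_density_term_eq zigzag_value_def fun_eq_iff)
  then show ?thesis
    using True by (simp add: nn_integral_cmult_indicator ennreal_mult_divide_eq)
qed

text \<open>Averaging over \<open>m\<close>, the only possible atom comes from
  \<open>m = p div 2\<close>, present exactly for even \<open>p\<close> and carrying weight
  \<open>1 / p\<close>.\<close>

lemma emeasure_distr_zigzag_value_eq:
  assumes "p > 0" and A: "A \<in> sets borel"
  shows "emeasure (distr (zigzag_model p) borel (zigzag_value p)) A =
    (\<integral>\<^sup>+x\<in>A. ennreal (zigzag_density p x) \<partial>lborel) + (if even p then ennreal (1 / real p) * indicator A 1 else 0)"
proof -
  have atom: "(\<Sum>m<p. if 2 * m = p then indicator A 1 else 0) = (if even p then indicator A (1::real) else (0::ennreal))"
  proof (cases "even p")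
    case True
    then have "2 * m = p \<longleftrightarrow> m = p div 2" for m by auto
    moreover have "p div 2 < p" using \<open>p > 0\<close> by simp
    ultimately show ?thesis using True by (simp add: sum.delta)
  qed (auto intro!: sum.neutral)
  have "ennreal (1 / real p) = ennreal 1 / ennreal (real p)"
    using \<open>p > 0\<close> by (intro divide_ennreal[symmetric]) auto
  then have "indicator A 1 / of_nat p = ennreal (1 / real p) * indicator A (1::real)"
    by (simp add: indicator_def ennreal_of_nat_eq_real_of_nat)
  then have atom_weight: "(if even p then indicator A (1::real) else (0::ennreal)) / of_nat p =
      (if even p then ennreal (1 / real p) * indicator A 1 else 0)"
    by simp
  have "emeasure (distr (zigzag_model p) borel (zigzag_value p)) A =
      (\<Sum>m<p. (\<integral>\<^sup>+x\<in>A. ennreal (zigzag_density_term p m x) \<partial>lborel) / ennreal pi +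
        (if 2 * m = p then indicator A 1 else 0)) / of_nat p"
    unfolding emeasure_distr_zigzag_value[OF assms]
    by (intro arg_cong2[where f="(/)"] sum.cong refl nn_integral_zigzag_value A) simp
  also have "\<dots> = (\<integral>\<^sup>+x\<in>A. ennreal (zigzag_density p x) \<partial>lborel) + (if even p then ennreal (1 / real p) * indicator A 1 else 0)"
    unfolding sum.distrib atom nn_integral_zigzag_density[OF assms] atom_weight[symmetric]
    by (simp add: divide_ennreal_def distrib_right)
  finally show ?thesis .
qed

text \<open>Compact support bounds \<open>X\<close>, the model is bounded by 9, and the two moment
  formulas coincide; hence the laws do.\<close>

lemma distr_dual_nanotube_eigenvalue:
  assumes "p > 0" and "dual_nanotube_eigenvalue p 0 M X"
  shows "distr M borel X = distr (zigzag_model p) borel (zigzag_value p)"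
proof -
  from assms(2) obtain K where K: "compact K" "AE \<omega> in M. X \<omega> \<in> K"
    unfolding dual_nanotube_eigenvalue_def by blast
  from compact_imp_bounded[OF K(1)] obtain B where B: "\<And>x. x \<in> K \<Longrightarrow> norm x \<le> B"
    unfolding bounded_iff by blast
  show ?thesis
  proof (rule distr_eq_if_bounded_moments_eq[where B=B and C=9])
    show "prob_space M" "X \<in> borel_measurable M"
      using assms(2) by (simp_all add: dual_nanotube_eigenvalue_def)
    show "AE \<omega> in M. \<bar>X \<omega>\<bar> \<le> B"
      using K(2) by eventually_elim (use B in auto)
    show "(\<integral>\<omega>. X \<omega> ^ k \<partial>M) = (\<integral>\<omega>. zigzag_value p \<omega> ^ k \<partial>zigzag_model p)" for k
    proof -
      have "complex_of_real (\<integral>\<omega>. X \<omega> ^ k \<partial>M) = dual_nanotube_moment p 0 k"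
        using assms(2) by (simp add: dual_nanotube_eigenvalue_def)
      also have "\<dots> = complex_of_real (\<integral>\<omega>. zigzag_value p \<omega> ^ k \<partial>zigzag_model p)"
        unfolding dual_nanotube_moment_zigzag[OF \<open>p > 0\<close>] zigzag_value_moment[OF \<open>p > 0\<close>]
        by (simp add: zigzag_value_def zigzag_radius_def)
      finally show ?thesis by (simp only: of_real_eq_iff)
    qed
  qed (simp_all add: prob_space_zigzag_model abs_zigzag_value_le)
qed

text \<open>For odd \<open>p\<close> no radius vanishes and the law has the stated density. For even
  \<open>p\<close> the index \<open>p / 2\<close> yields an atom of mass \<open>1 / p\<close> at 1,
  so the formula is the density of the absolutely continuous part, and the atom is stated
  separately.\<close>

theorem proposition4:
  fixes p :: nat and M :: "'a measure" and X :: "'a \<Rightarrow> real"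
  assumes "p \<ge> 5"
    and "dual_nanotube_eigenvalue p 0 M X"
  shows "(odd p \<longrightarrow> distributed M lborel X (\<lambda>x. ennreal (zigzag_density p x))) \<and>
    (even p \<longrightarrow> (\<forall>A\<in>sets borel. emeasure (distr M borel X) A =
       (\<integral>\<^sup>+x\<in>A. ennreal (zigzag_density p x) \<partial>lborel) + ennreal (1 / real p) * indicator A 1))"
proof (intro conjI impI ballI)
  have "p > 0" using assms(1) by simp
  note law = distr_dual_nanotube_eigenvalue[OF this assms(2)] emeasure_distr_zigzag_value_eq[OF this]
  note [measurable] = measurable_zigzag_density[OF \<open>p > 0\<close>]
  {
    assume "odd p"
    \<comment> \<open>\<open>distributed\<close> refers to \<open>lborel\<close> as target, but only
      its sigma-algebra enters the image measure.\<close>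
    have "distr M lborel X = distr M borel X"
      by (rule distr_cong) auto
    also have "\<dots> = density lborel (\<lambda>x. ennreal (zigzag_density p x))"
      by (rule measure_eqI) (use \<open>odd p\<close> in \<open>simp_all add: law emeasure_density\<close>)
    finally show "distributed M lborel X (\<lambda>x. ennreal (zigzag_density p x))"
      using assms(2) by (simp add: distributed_def dual_nanotube_eigenvalue_def)
  next
    fix A :: "real set"
    assume "even p" "A \<in> sets borel"
    then show "emeasure (distr M borel X) A =
       (\<integral>\<^sup>+x\<in>A. ennreal (zigzag_density p x) \<partial>lborel) + ennreal (1 / real p) * indicator A 1"
      by (simp add: law)
  }
qed

end
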